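(* Let $G$ be a complete $t$-partite graph (with $t$ nonempty parts), $t\ge 3$. Then $sn(G)=t-1$.
   Context: Graphs are finite, undirected and simple. Let $G=(V,E)$ be a connected graph with chromatic number $\chi(G)=k\ge 2$. For $S\subset V$, a partial coloring on $G[S]$ is a proper coloring $\mathscr C_0$ of the induced subgraph $G[S]$ with colors from $\{1,\dots,k\}$ (not all colors need be used). It is a Sudoku coloring of $G$ if there is exactly one proper $k$-coloring $V\to\{1,\dots,k\}$ of $G$ whose restriction to $S$ is $\mathscr C_0$. The Sudoku number $sn(G)$ is the smallest $|S|$ such that $G[S]$ admits a Sudoku coloring of $G$. *)

theory Defs
  imports
    "Graph_Theory.Digraph_Component"
    "HOL-Library.FuncSet"
    "HOL-Library.Disjoint_Sets"
begin

text \<open>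
  Finite simple undirected graphs are those satisfying \<open>graph\<close>, that is, finite symmetric
  digraphs without loops and parallel arcs: an edge is a pair of opposite arcs.

  Colorings are functions \<open>verts G \<rightarrow>\<^sub>E {1..k}\<close>, pinned to \<open>undefined\<close> outside
  the vertex set, so that equality of functions is equality of colorings.
\<close>

definition proper_colorings :: "('a, 'b) pre_digraph \<Rightarrow> nat \<Rightarrow> ('a \<Rightarrow> nat) set" where
  "proper_colorings G k =
     {c \<in> verts G \<rightarrow>\<^sub>E {1..k}. \<forall>u v. u \<rightarrow>\<^bsub>G\<^esub> v \<longrightarrow> c u \<noteq> c v}"

definition chromatic_number :: "('a, 'b) pre_digraph \<Rightarrow> nat" where
  "chromatic_number G = (LEAST k. proper_colorings G k \<noteq> {})"

definition partial_coloring :: "('a, 'b) pre_digraph \<Rightarrow> 'a set \<Rightarrow> ('a \<Rightarrow> nat) \<Rightarrow> bool" where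
  "partial_coloring G S c\<^sub>0 \<longleftrightarrow>
     S \<subseteq> verts G \<and> c\<^sub>0 \<in> proper_colorings (G \<restriction> S) (chromatic_number G)"

definition sudoku_coloring :: "('a, 'b) pre_digraph \<Rightarrow> 'a set \<Rightarrow> ('a \<Rightarrow> nat) \<Rightarrow> bool" where
  "sudoku_coloring G S c\<^sub>0 \<longleftrightarrow> partial_coloring G S c\<^sub>0 \<and>
     (\<exists>!c. c \<in> proper_colorings G (chromatic_number G) \<and> restrict c S = c\<^sub>0)"

text \<open>
  Meant for connected \<open>G\<close> with chromatic number at least 2; the minimum exists for every
  \<open>graph G\<close>, since any proper coloring with \<open>chromatic_number G\<close> colors is a Sudoku coloring with
  \<open>S = verts G\<close>.
\<close>
definition sudoku_number :: "('a, 'b) pre_digraph \<Rightarrow> nat" where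
  "sudoku_number G = (LEAST n. \<exists>S c\<^sub>0. sudoku_coloring G S c\<^sub>0 \<and> card S = n)"

text \<open>The parts are nonempty because the blocks of a \<open>partition_on\<close> are.\<close>
definition complete_multipartite :: "nat \<Rightarrow> ('a, 'b) pre_digraph \<Rightarrow> bool" where
  "complete_multipartite t G \<longleftrightarrow> graph G \<and>
     (\<exists>P. partition_on (verts G) P \<and> card P = t \<and>
       arcs_ends G = {(u, v). \<exists>A\<in>P. \<exists>B\<in>P. A \<noteq> B \<and> u \<in> A \<and> v \<in> B})"

end

theory Submission
  imports Defs "HOL-Combinatorics.Transposition"
begin

text \<open>
  A proper \<open>t\<close>-coloring of a complete \<open>t\<close>-partite graph is constant on each part, since the
  parts use pairwise disjoint nonempty sets of colors. Hence representatives of \<open>t - 1\<close> parts in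
  distinct colors determine the coloring, the last part receiving the remaining color. If \<open>S\<close> has
  fewer than \<open>t - 1\<close> vertices, it misses two parts, and exchanging a color of the first with a
  color of the second changes the coloring but not its restriction to \<open>S\<close>.
\<close>

lemma proper_coloringsI:
  assumes "c \<in> verts G \<rightarrow>\<^sub>E {1..k}" "\<And>u v. u \<rightarrow>\<^bsub>G\<^esub> v \<Longrightarrow> c u \<noteq> c v"
  shows "c \<in> proper_colorings G k"
  using assms unfolding proper_colorings_def by blast

lemma proper_colorings_adj:
  assumes "c \<in> proper_colorings G k" "u \<rightarrow>\<^bsub>G\<^esub> v"
  shows "c u \<noteq> c v"
  using assms unfolding proper_colorings_def by blast

lemma proper_colorings_range:
  assumes "c \<in> proper_colorings G k" "v \<in> verts G"
  shows "c v \<in> {1..k}"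
  using assms unfolding proper_colorings_def by blast

lemma proper_colorings_undefined:
  assumes "c \<in> proper_colorings G k" "v \<notin> verts G"
  shows "c v = undefined"
  using assms unfolding proper_colorings_def by (blast dest: PiE_arb)

lemma restrict_proper_coloring:
  assumes "c \<in> proper_colorings G k" "S \<subseteq> verts G"
  shows "restrict c S \<in> proper_colorings (G \<restriction> S) k"
proof (rule proper_coloringsI)
  show "restrict c S \<in> verts (G \<restriction> S) \<rightarrow>\<^sub>E {1..k}"
    using assms proper_colorings_range[OF assms(1)] by auto
next
  fix u v assume "u \<rightarrow>\<^bsub>G \<restriction> S\<^esub> v"
  then have "u \<in> S" "v \<in> S" "u \<rightarrow>\<^bsub>G\<^esub> v"
    by (auto simp: arcs_ends_def arc_to_ends_def induce_subgraph_def)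
  then show "restrict c S u \<noteq> restrict c S v"
    using proper_colorings_adj[OF assms(1)] by simp
qed

text \<open>An injective renaming of colors keeps adjacent vertices apart. The restriction resets
  the values outside \<open>verts G\<close> to \<open>undefined\<close>, and \<open>ends\<close>
  ensures that it leaves both ends of an arc untouched.\<close>

lemma permute_proper_coloring:
  assumes "c \<in> proper_colorings G k" "inj f" "f ` {1..k} \<subseteq> {1..k}"
    and ends: "\<And>u v. u \<rightarrow>\<^bsub>G\<^esub> v \<Longrightarrow> u \<in> verts G \<and> v \<in> verts G"
  shows "restrict (f \<circ> c) (verts G) \<in> proper_colorings G k"
proof (rule proper_coloringsI)
  show "restrict (f \<circ> c) (verts G) \<in> verts G \<rightarrow>\<^sub>E {1..k}"
    using assms(3) proper_colorings_range[OF assms(1)] by fastforce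
next
  fix u v assume uv: "u \<rightarrow>\<^bsub>G\<^esub> v"
  show "restrict (f \<circ> c) (verts G) u \<noteq> restrict (f \<circ> c) (verts G) v"
    using ends[OF uv] proper_colorings_adj[OF assms(1) uv] \<open>inj f\<close> by (simp add: inj_eq)
qed

text \<open>Replaces the set of blocks by the map from a point to its block, so that lying in
  different parts becomes an inequality of values of \<open>p\<close>.\<close>

lemma partition_part_map:
  assumes "partition_on A P"
  obtains p where "p ` A = P" "\<And>B a. B \<in> P \<Longrightarrow> a \<in> B \<Longrightarrow> p a = B" "\<And>a. a \<in> A \<Longrightarrow> a \<in> p a"
proof -
  from assms have "\<forall>a\<in>A. \<exists>B\<in>P. a \<in> B"
    unfolding partition_on_def by blast
  then obtain p where p: "\<And>a. a \<in> A \<Longrightarrow> p a \<in> P \<and> a \<in> p a"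
    by metis
  have eq: "p a = B" if "B \<in> P" "a \<in> B" for a B
    using that p[of a] assms unfolding partition_on_def disjoint_def by blast
  have "B \<in> p ` A" if "B \<in> P" for B
  proof -
    have "B \<noteq> {}" "B \<subseteq> A"
      using that assms unfolding partition_on_def by auto
    then obtain a where "a \<in> B" "a \<in> A" by blast
    then show ?thesis using eq[OF that] by blast
  qed
  with p have "p ` A = P" by blast
  from that[OF this] eq p show thesis by blast
qed

text \<open>Complete multipartite graphs with \<open>p\<close> naming the part of a vertex and
  \<open>s\<close> choosing a vertex in each part; the parts are the values of \<open>p\<close> on
  the vertices.\<close>

locale multipartite =
  fixes G :: "('a, 'b) pre_digraph" and p :: "'a \<Rightarrow> 'c" and s :: "'c \<Rightarrow> 'a"
  assumes finite_verts: "finite (verts G)"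
    and adj_iff: "u \<rightarrow>\<^bsub>G\<^esub> v \<longleftrightarrow> u \<in> verts G \<and> v \<in> verts G \<and> p u \<noteq> p v"
    and representative: "q \<in> p ` verts G \<Longrightarrow> s q \<in> verts G \<and> p (s q) = q"
begin

abbreviation "parts \<equiv> p ` verts G"

lemma finite_parts: "finite parts"
  using finite_verts by simp

text \<open>The representatives form a clique, since distinct parts are completely joined.\<close>

lemma inj_on_coloring_representatives:
  assumes "c \<in> proper_colorings G k"
  shows "inj_on (c \<circ> s) parts"
proof (rule inj_onI)
  fix q r assume "q \<in> parts" "r \<in> parts" "(c \<circ> s) q = (c \<circ> s) r"
  then show "q = r"
    using representative proper_colorings_adj[OF assms, of "s q" "s r"] adj_iff by auto
qed

lemma coloring_representatives_subset:
  assumes "c \<in> proper_colorings G k"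
  shows "(c \<circ> s) ` parts \<subseteq> {1..k}"
proof (rule image_subsetI)
  fix q assume "q \<in> parts"
  then have "s q \<in> verts G" using representative by blast
  then show "(c \<circ> s) q \<in> {1..k}" using proper_colorings_range[OF assms] by simp
qed

lemma proper_coloring_exists: "proper_colorings G (card parts) \<noteq> {}"
proof -
  obtain f where f: "bij_betw f parts {1..card parts}"
    using finite_same_card_bij[OF finite_parts, of "{1..card parts}"] by auto
  have "restrict (f \<circ> p) (verts G) \<in> proper_colorings G (card parts)"
  proof (rule proper_coloringsI)
    show "restrict (f \<circ> p) (verts G) \<in> verts G \<rightarrow>\<^sub>E {1..card parts}"
      using bij_betwE[OF f] by auto
  next
    fix u v assume "u \<rightarrow>\<^bsub>G\<^esub> v"
    then show "restrict (f \<circ> p) (verts G) u \<noteq> restrict (f \<circ> p) (verts G) v"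
      using bij_betw_imp_inj_on[OF f] by (auto simp: adj_iff dest: inj_onD)
  qed
  then show ?thesis by blast
qed

text \<open>Coloring by parts gives the upper bound, the clique of representatives the lower
  one.\<close>

lemma chromatic_number_eq: "chromatic_number G = card parts"
  unfolding chromatic_number_def
proof (rule Least_equality)
  fix k assume "proper_colorings G k \<noteq> {}"
  then obtain c where "c \<in> proper_colorings G k" by blast
  from card_inj_on_le[OF inj_on_coloring_representatives[OF this]
      coloring_representatives_subset[OF this]]
  show "card parts \<le> k" by simp
qed (rule proper_coloring_exists)

text \<open>By counting: an injective image of the parts in a set of the same finite size is the
  whole set.\<close>

lemma coloring_representatives_eq:
  assumes "c \<in> proper_colorings G (card parts)"
  shows "(c \<circ> s) ` parts = {1..card parts}"
proof (rule card_subset_eq[OF _ coloring_representatives_subset[OF assms]])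
  show "card ((c \<circ> s) ` parts) = card {1..card parts}"
    using card_image[OF inj_on_coloring_representatives[OF assms]] by (rule trans) simp
qed simp

text \<open>Every color already occurs on a representative, so \<open>v\<close> has the color of
  some \<open>s q\<close>. Vertices of equal color are not adjacent, which forces
  \<open>q = p v\<close>.\<close>

lemma coloring_eq_representative:
  assumes "c \<in> proper_colorings G (card parts)" "v \<in> verts G"
  shows "c v = c (s (p v))"
proof -
  obtain q where "q \<in> parts" "c v = c (s q)"
    using proper_colorings_range[OF assms] coloring_representatives_eq[OF assms(1)] by fastforce
  then show ?thesis
    using proper_colorings_adj[OF assms(1), of v "s q"] adj_iff representative assms(2) by metis
qed

text \<open>Colors of representatives fix the coloring, and the one at \<open>s r\<close> is the
  color left over by the others.\<close>

lemma coloring_determined: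
  assumes c: "c \<in> proper_colorings G (card parts)" and d: "d \<in> proper_colorings G (card parts)"
    and agree: "\<And>q. q \<in> parts - {r} \<Longrightarrow> c (s q) = d (s q)"
  shows "c = d"
proof -
  have last: "c (s r) = d (s r)" if "r \<in> parts"
  proof -
    \<comment> \<open>Both colorings use all colors on the representatives. If \<open>d\<close> gave
      the color \<open>c (s r)\<close> to another \<open>s q\<close>, agreement at \<open>q\<close>
      would make \<open>c\<close> repeat a color on the clique.\<close>
    have "(c \<circ> s) r \<in> (d \<circ> s) ` parts"
      using coloring_representatives_eq[OF c] coloring_representatives_eq[OF d] that by blast
    then obtain q where q: "q \<in> parts" "c (s r) = d (s q)" by auto
    show ?thesis
    proof (cases "q = r")
      case False
      then have "c (s r) = c (s q)" using agree q by simp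
      then have "r = q"
        using inj_onD[OF inj_on_coloring_representatives[OF c] _ that \<open>q \<in> parts\<close>] q by simp
      with False show ?thesis by simp
    qed (use q in simp)
  qed
  show ?thesis
  proof
    fix v
    show "c v = d v"
    proof (cases "v \<in> verts G")
      case True
      then have "c (s (p v)) = d (s (p v))"
        using agree last by (cases "p v = r") auto
      then show ?thesis
        using coloring_eq_representative[OF c True] coloring_eq_representative[OF d True] by simp
    qed (simp add: proper_colorings_undefined[OF c] proper_colorings_undefined[OF d])
  qed
qed

lemma sudoku_coloring_representatives:
  assumes "c \<in> proper_colorings G (card parts)"
  shows "sudoku_coloring G (s ` (parts - {r})) (restrict c (s ` (parts - {r})))"
proof -
  let ?S = "s ` (parts - {r})"
  have "?S \<subseteq> verts G" using representative by blast
  moreover have "d = c"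
    if "d \<in> proper_colorings G (card parts)" "restrict d ?S = restrict c ?S" for d
  proof (rule coloring_determined[OF that(1) assms])
    fix q assume "q \<in> parts - {r}"
    then show "d (s q) = c (s q)"
      using fun_cong[OF that(2), of "s q"] by simp
  qed
  ultimately show ?thesis
    unfolding sudoku_coloring_def partial_coloring_def chromatic_number_eq
    using assms restrict_proper_coloring by (intro conjI ex1I[of _ c]) auto
qed

lemma sudoku_coloring_card_ge:
  assumes "sudoku_coloring G S c\<^sub>0"
  shows "card parts - 1 \<le> card S"
proof (rule ccontr)
  assume less: "\<not> card parts - 1 \<le> card S"
  from assms have S: "S \<subseteq> verts G"
    unfolding sudoku_coloring_def partial_coloring_def by blast
  then have "finite S" using finite_verts finite_subset by blast
  then have "card (p ` S) \<le> card S" by (rule card_image_le)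
  moreover have "card (parts - p ` S) = card parts - card (p ` S)"
    using S \<open>finite S\<close> by (intro card_Diff_subset) auto
  \<comment> \<open>Each vertex of \<open>S\<close> meets one part, and \<open>S\<close> has fewer
    than \<open>card parts - 1\<close> vertices, so at least two parts are missed.\<close>
  ultimately have "\<not> card (parts - p ` S) \<le> Suc 0" using less by linarith
  then obtain q r where qr: "q \<in> parts - p ` S" "r \<in> parts - p ` S" "q \<noteq> r"
    using finite_parts card_le_Suc0_iff_eq[of "parts - p ` S"] by blast
  obtain c where c: "c \<in> proper_colorings G (card parts)" "restrict c S = c\<^sub>0"
    and unique: "\<And>d. d \<in> proper_colorings G (card parts) \<Longrightarrow> restrict d S = c\<^sub>0 \<Longrightarrow> d = c"
    using assms unfolding sudoku_coloring_def chromatic_number_eq by blast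
  \<comment> \<open>The competing coloring swaps the colors of the two missed parts
    everywhere.\<close>
  let ?f = "transpose (c (s q)) (c (s r))"
  let ?d = "restrict (?f \<circ> c) (verts G)"
  have sq: "s q \<in> verts G" "p (s q) = q" and sr: "s r \<in> verts G" "p (s r) = r"
    using representative qr by auto
  have "?f ` {1..card parts} \<subseteq> {1..card parts}"
    using proper_colorings_range[OF c(1) sq(1)] proper_colorings_range[OF c(1) sr(1)]
    by (intro image_subsetI) (simp add: transpose_def)
  then have "?d \<in> proper_colorings G (card parts)"
    by (intro permute_proper_coloring[OF c(1)]) (simp_all add: adj_iff)
  \<comment> \<open>A vertex of \<open>S\<close> lies in neither missed part, hence is adjacent to
    both \<open>s q\<close> and \<open>s r\<close>; its color is neither of the swapped
    ones.\<close>
  moreover have "restrict ?d S = restrict c S"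
  proof (rule restrict_ext)
    fix v assume "v \<in> S"
    then have "v \<in> verts G" "p v \<noteq> q" "p v \<noteq> r" using S qr by blast+
    then have "v \<rightarrow>\<^bsub>G\<^esub> s q" "v \<rightarrow>\<^bsub>G\<^esub> s r"
      using sq sr by (simp_all add: adj_iff)
    then have "c v \<noteq> c (s q)" "c v \<noteq> c (s r)"
      using proper_colorings_adj[OF c(1)] by blast+
    then show "?d v = c v" using \<open>v \<in> verts G\<close> by simp
  qed
  ultimately have "?d = c" using unique[of ?d] unfolding c(2) by blast
  \<comment> \<open>At \<open>s q\<close> the swapped coloring takes the value
    \<open>c (s r)\<close>, so uniqueness would give two adjacent vertices the same color.\<close>
  from fun_cong[OF this, of "s q"] have "c (s r) = c (s q)" using sq(1) by simp
  moreover have "s r \<rightarrow>\<^bsub>G\<^esub> s q" using sq sr qr(3) by (simp add: adj_iff)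
  ultimately show False using proper_colorings_adj[OF c(1)] by blast
qed

lemma sudoku_number_eq:
  assumes "verts G \<noteq> {}"
  shows "sudoku_number G = card parts - 1"
  unfolding sudoku_number_def
proof (rule Least_equality)
  obtain c where "c \<in> proper_colorings G (card parts)"
    using proper_coloring_exists by blast
  \<comment> \<open>A vertex supplies the part to leave out, so that exactly
    \<open>card parts - 1\<close> representatives remain.\<close>
  moreover obtain r where "r \<in> parts" using assms by blast
  moreover have "inj_on s parts" by (metis inj_onI representative)
  then have "card (s ` (parts - {r})) = card (parts - {r})"
    by (intro card_image) (rule inj_on_subset, auto)
  ultimately show "\<exists>S c\<^sub>0. sudoku_coloring G S c\<^sub>0 \<and> card S = card parts - 1"
    using sudoku_coloring_representatives by (metis card_Diff_singleton)
next
  fix n assume "\<exists>S c\<^sub>0. sudoku_coloring G S c\<^sub>0 \<and> card S = n"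
  then show "card parts - 1 \<le> n" using sudoku_coloring_card_ge by blast
qed

end

theorem corollary3p4:
  fixes G :: "('a, 'b) pre_digraph" and t :: nat
  assumes "complete_multipartite t G" and "t \<ge> 3"
  shows "sudoku_number G = t - 1"
proof -
  from assms(1) obtain P where "graph G" and P: "partition_on (verts G) P" "card P = t"
    and arcs: "arcs_ends G = {(u, v). \<exists>A\<in>P. \<exists>B\<in>P. A \<noteq> B \<and> u \<in> A \<and> v \<in> B}"
    unfolding complete_multipartite_def by blast
  then interpret graph G by simp
  obtain p where p: "p ` verts G = P" "\<And>B a. B \<in> P \<Longrightarrow> a \<in> B \<Longrightarrow> p a = B"
    "\<And>a. a \<in> verts G \<Longrightarrow> a \<in> p a"
    using partition_part_map[OF P(1)] by blast
  have sub: "a \<in> verts G" if "B \<in> P" "a \<in> B" for a B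
    using P(1) that unfolding partition_on_def by blast
  interpret multipartite G p "inv_into (verts G) p"
  proof
    show "u \<rightarrow>\<^bsub>G\<^esub> v \<longleftrightarrow> u \<in> verts G \<and> v \<in> verts G \<and> p u \<noteq> p v" for u v
    proof
      assume "u \<rightarrow>\<^bsub>G\<^esub> v"
      then obtain A B where AB: "A \<in> P" "B \<in> P" "A \<noteq> B" "u \<in> A" "v \<in> B"
        unfolding arcs by blast
      then have "p u = A" "p v = B" using p(2) by auto
      with AB sub show "u \<in> verts G \<and> v \<in> verts G \<and> p u \<noteq> p v" by blast
    next
      assume uv: "u \<in> verts G \<and> v \<in> verts G \<and> p u \<noteq> p v"
      then have "p u \<in> P" "p v \<in> P" using p(1) by auto
      with uv p(3) show "u \<rightarrow>\<^bsub>G\<^esub> v" unfolding arcs by blast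
    qed
  qed (simp_all add: inv_into_into f_inv_into_f)
  \<comment> \<open>Without vertices the image \<open>P\<close> of \<open>p\<close> would be empty,
    against \<open>card P = t\<close>.\<close>
  from P(2) \<open>t \<ge> 3\<close> have "verts G \<noteq> {}" using p(1) by auto
  then show ?thesis using sudoku_number_eq P(2) p(1) by simp
qed

end
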